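(* Let $n\ge1$. For the graph $\Phi(\mathbb H(\mathbb Z_{2^n}))$: (i) the minimum degree is $2^{4n-1}-1$ if $n=1$ and $2^{4n-1}-2$ if $n>1$; (ii) the maximum degree is $2^{4n}-3$ if $n=1$ and $2^{4n}-4$ if $n>1$; (iii) the girth is $3$.
   Context: $\mathbb H(\mathbb Z_{2^n})$ is the ring of Hamilton quaternions over $\mathbb Z_{2^n}$. Its elements are $a_1+a_2i+a_3j+a_4k$ with $a_i\in\mathbb Z_{2^n}$, written $(a_1,a_2,a_3,a_4)$. Addition is coordinatewise, and multiplication is determined by distributivity, scalars commuting with $i,j,k$, and $i^2=j^2=k^2=-1$, $ij=-ji=k$, $jk=-kj=i$, $ki=-ik=j$. For a ring $R$ with unity, the non-zero divisor graph $\Phi(R)$ is the simple graph with vertex set $R\setminus\{0,1,-1\}$ in which two distinct vertices $x,y$ are adjacent if and only if $xy\neq0$ or $yx\neq0$. *)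

theory Defs
  imports
    "HOL-Number_Theory.Residues"
    "HOL-Library.Extended_Nat"
    "Graph_Theory.Graph_Theory"
begin

text \<open>
  The quadruple \<open>(a1, a2, a3, a4)\<close> stands for \<open>a1 + a2 i + a3 j + a4 k\<close>. The product is the
  bilinear extension of \<open>i\<^sup>2 = j\<^sup>2 = k\<^sup>2 = -1\<close>, \<open>ij = -ji = k\<close>, \<open>jk = -kj = i\<close>, \<open>ki = -ik = j\<close>;
  see \<open>quat_ring_ring\<close> and \<open>quat_ring_relations\<close> below.
\<close>

type_synonym 'a quat = "'a \<times> 'a \<times> 'a \<times> 'a"

fun quat_mult :: "('a, 'b) ring_scheme \<Rightarrow> 'a quat \<Rightarrow> 'a quat \<Rightarrow> 'a quat" where
  "quat_mult R (a1, a2, a3, a4) (b1, b2, b3, b4) =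
    (a1 \<otimes>\<^bsub>R\<^esub> b1 \<ominus>\<^bsub>R\<^esub> a2 \<otimes>\<^bsub>R\<^esub> b2 \<ominus>\<^bsub>R\<^esub> a3 \<otimes>\<^bsub>R\<^esub> b3 \<ominus>\<^bsub>R\<^esub> a4 \<otimes>\<^bsub>R\<^esub> b4,
     a1 \<otimes>\<^bsub>R\<^esub> b2 \<oplus>\<^bsub>R\<^esub> a2 \<otimes>\<^bsub>R\<^esub> b1 \<oplus>\<^bsub>R\<^esub> a3 \<otimes>\<^bsub>R\<^esub> b4 \<ominus>\<^bsub>R\<^esub> a4 \<otimes>\<^bsub>R\<^esub> b3,
     a1 \<otimes>\<^bsub>R\<^esub> b3 \<ominus>\<^bsub>R\<^esub> a2 \<otimes>\<^bsub>R\<^esub> b4 \<oplus>\<^bsub>R\<^esub> a3 \<otimes>\<^bsub>R\<^esub> b1 \<oplus>\<^bsub>R\<^esub> a4 \<otimes>\<^bsub>R\<^esub> b2,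
     a1 \<otimes>\<^bsub>R\<^esub> b4 \<oplus>\<^bsub>R\<^esub> a2 \<otimes>\<^bsub>R\<^esub> b3 \<ominus>\<^bsub>R\<^esub> a3 \<otimes>\<^bsub>R\<^esub> b2 \<oplus>\<^bsub>R\<^esub> a4 \<otimes>\<^bsub>R\<^esub> b1)"

fun quat_add :: "('a, 'b) ring_scheme \<Rightarrow> 'a quat \<Rightarrow> 'a quat \<Rightarrow> 'a quat" where
  "quat_add R (a1, a2, a3, a4) (b1, b2, b3, b4) =
    (a1 \<oplus>\<^bsub>R\<^esub> b1, a2 \<oplus>\<^bsub>R\<^esub> b2, a3 \<oplus>\<^bsub>R\<^esub> b3, a4 \<oplus>\<^bsub>R\<^esub> b4)"

definition quat_ring :: "('a, 'b) ring_scheme \<Rightarrow> 'a quat ring" where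
  "quat_ring R =
    \<lparr>carrier = carrier R \<times> carrier R \<times> carrier R \<times> carrier R,
     monoid.mult = quat_mult R,
     one = (\<one>\<^bsub>R\<^esub>, \<zero>\<^bsub>R\<^esub>, \<zero>\<^bsub>R\<^esub>, \<zero>\<^bsub>R\<^esub>),
     zero = (\<zero>\<^bsub>R\<^esub>, \<zero>\<^bsub>R\<^esub>, \<zero>\<^bsub>R\<^esub>, \<zero>\<^bsub>R\<^esub>),
     add = quat_add R\<rparr>"

context cring
begin

lemma quat_ring_ring: "ring (quat_ring R)"
proof (rule ringI)
  show "abelian_group (quat_ring R)"
  proof (rule abelian_groupI)
    fix x assume "x \<in> carrier (quat_ring R)"
    then obtain a b c d where x: "x = (a, b, c, d)" "{a, b, c, d} \<subseteq> carrier R"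
      by (auto simp: quat_ring_def)
    show "\<exists>y \<in> carrier (quat_ring R). y \<oplus>\<^bsub>quat_ring R\<^esub> x = \<zero>\<^bsub>quat_ring R\<^esub>"
      by (rule bexI[of _ "(\<ominus> a, \<ominus> b, \<ominus> c, \<ominus> d)"]) (use x in \<open>auto simp: quat_ring_def l_neg\<close>)
  qed (auto simp: quat_ring_def a_ac)
  show "monoid (quat_ring R)"
  proof (rule monoidI)
    fix x y z
    assume "x \<in> carrier (quat_ring R)" "y \<in> carrier (quat_ring R)" "z \<in> carrier (quat_ring R)"
    then show "x \<otimes>\<^bsub>quat_ring R\<^esub> y \<otimes>\<^bsub>quat_ring R\<^esub> z = x \<otimes>\<^bsub>quat_ring R\<^esub> (y \<otimes>\<^bsub>quat_ring R\<^esub> z)"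
      by (cases x; cases y; cases z)
        (simp add: quat_ring_def minus_eq minus_add l_distr r_distr l_minus r_minus m_assoc a_ac)
  qed (auto simp: quat_ring_def minus_eq)
qed (auto simp: quat_ring_def minus_eq minus_add l_distr r_distr l_minus r_minus a_ac)

lemma quat_ring_relations:
  defines "H \<equiv> quat_ring R"
  defines "i \<equiv> (\<zero>, \<one>, \<zero>, \<zero>)" and "j \<equiv> (\<zero>, \<zero>, \<one>, \<zero>)" and "k \<equiv> (\<zero>, \<zero>, \<zero>, \<one>)"
  shows "i \<otimes>\<^bsub>H\<^esub> i = \<ominus>\<^bsub>H\<^esub> \<one>\<^bsub>H\<^esub>" "j \<otimes>\<^bsub>H\<^esub> j = \<ominus>\<^bsub>H\<^esub> \<one>\<^bsub>H\<^esub>" "k \<otimes>\<^bsub>H\<^esub> k = \<ominus>\<^bsub>H\<^esub> \<one>\<^bsub>H\<^esub>"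
    "i \<otimes>\<^bsub>H\<^esub> j = k" "j \<otimes>\<^bsub>H\<^esub> i = \<ominus>\<^bsub>H\<^esub> k"
    "j \<otimes>\<^bsub>H\<^esub> k = i" "k \<otimes>\<^bsub>H\<^esub> j = \<ominus>\<^bsub>H\<^esub> i"
    "k \<otimes>\<^bsub>H\<^esub> i = j" "i \<otimes>\<^bsub>H\<^esub> k = \<ominus>\<^bsub>H\<^esub> j"
    "\<lbrakk>r \<in> carrier R; a \<in> carrier R; b \<in> carrier R; c \<in> carrier R; d \<in> carrier R\<rbrakk>
      \<Longrightarrow> (r, \<zero>, \<zero>, \<zero>) \<otimes>\<^bsub>H\<^esub> (a, b, c, d) = (r \<otimes> a, r \<otimes> b, r \<otimes> c, r \<otimes> d)"
    "\<lbrakk>r \<in> carrier R; a \<in> carrier R; b \<in> carrier R; c \<in> carrier R; d \<in> carrier R\<rbrakk>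
      \<Longrightarrow> (a, b, c, d) \<otimes>\<^bsub>H\<^esub> (r, \<zero>, \<zero>, \<zero>) = (r \<otimes> a, r \<otimes> b, r \<otimes> c, r \<otimes> d)"
proof -
  interpret H: ring H unfolding H_def by (rule quat_ring_ring)
  have neg: "\<ominus>\<^bsub>H\<^esub> (a, b, c, d) = (\<ominus> a, \<ominus> b, \<ominus> c, \<ominus> d)"
    if "a \<in> carrier R" "b \<in> carrier R" "c \<in> carrier R" "d \<in> carrier R" for a b c d
    by (rule H.minus_equality) (use that in \<open>auto simp: H_def quat_ring_def l_neg\<close>)
  have one: "\<one>\<^bsub>H\<^esub> = (\<one>, \<zero>, \<zero>, \<zero>)" by (simp add: H_def quat_ring_def)
  have mult: "x \<otimes>\<^bsub>H\<^esub> y = quat_mult R x y" for x y by (simp add: H_def quat_ring_def)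
  show "i \<otimes>\<^bsub>H\<^esub> i = \<ominus>\<^bsub>H\<^esub> \<one>\<^bsub>H\<^esub>" "j \<otimes>\<^bsub>H\<^esub> j = \<ominus>\<^bsub>H\<^esub> \<one>\<^bsub>H\<^esub>" "k \<otimes>\<^bsub>H\<^esub> k = \<ominus>\<^bsub>H\<^esub> \<one>\<^bsub>H\<^esub>"
    "i \<otimes>\<^bsub>H\<^esub> j = k" "j \<otimes>\<^bsub>H\<^esub> i = \<ominus>\<^bsub>H\<^esub> k"
    "j \<otimes>\<^bsub>H\<^esub> k = i" "k \<otimes>\<^bsub>H\<^esub> j = \<ominus>\<^bsub>H\<^esub> i"
    "k \<otimes>\<^bsub>H\<^esub> i = j" "i \<otimes>\<^bsub>H\<^esub> k = \<ominus>\<^bsub>H\<^esub> j"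
    unfolding i_def j_def k_def one mult by (simp_all add: neg minus_eq)
  show "(r, \<zero>, \<zero>, \<zero>) \<otimes>\<^bsub>H\<^esub> (a, b, c, d) = (r \<otimes> a, r \<otimes> b, r \<otimes> c, r \<otimes> d)"
    "(a, b, c, d) \<otimes>\<^bsub>H\<^esub> (r, \<zero>, \<zero>, \<zero>) = (r \<otimes> a, r \<otimes> b, r \<otimes> c, r \<otimes> d)"
    if "r \<in> carrier R" "a \<in> carrier R" "b \<in> carrier R" "c \<in> carrier R" "d \<in> carrier R"
    unfolding mult using that by (simp_all add: minus_eq m_comm)
qed

end

text \<open>
  A simple graph is represented, as in the \<open>pair_graph\<close> locale, by a symmetric loop-free set of
  arcs, so that each edge \<open>{x, y}\<close> gives the two arcs \<open>(x, y)\<close> and \<open>(y, x)\<close>.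
\<close>

definition nonzero_divisor_graph :: "('a, 'b) ring_scheme \<Rightarrow> 'a pair_pre_digraph" where
  "nonzero_divisor_graph R =
    (let V = carrier R - {\<zero>\<^bsub>R\<^esub>, \<one>\<^bsub>R\<^esub>, \<ominus>\<^bsub>R\<^esub> \<one>\<^bsub>R\<^esub>}
     in \<lparr>pverts = V,
         parcs = {(x, y). x \<in> V \<and> y \<in> V \<and> x \<noteq> y \<and>
           (x \<otimes>\<^bsub>R\<^esub> y \<noteq> \<zero>\<^bsub>R\<^esub> \<or> y \<otimes>\<^bsub>R\<^esub> x \<noteq> \<zero>\<^bsub>R\<^esub>)}\<rparr>)"

lemma pair_graph_nonzero_divisor_graph:
  assumes "finite (carrier R)"
  shows "pair_graph (nonzero_divisor_graph R)"
proof
  show "finite (parcs (nonzero_divisor_graph R))"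
    by (rule finite_subset[of _ "carrier R \<times> carrier R"])
      (use assms in \<open>auto simp: nonzero_divisor_graph_def Let_def\<close>)
qed (use assms in \<open>auto simp: nonzero_divisor_graph_def Let_def symmetric_def sym_def\<close>)

text \<open>
  In a symmetric loop-free digraph the out-degree of a vertex is the number of its neighbours.
  The minimum and maximum are meaningful for finite graphs with at least one vertex.
\<close>

definition min_degree :: "('a, 'b) pre_digraph \<Rightarrow> nat" where
  "min_degree G = Min (out_degree G ` verts G)"

definition max_degree :: "('a, 'b) pre_digraph \<Rightarrow> nat" where
  "max_degree G = Max (out_degree G ` verts G)"

text \<open>
  The predicate \<open>cycle\<close> also accepts the closed walk \<open>x, y, x\<close> along a single edge, which is not a
  cycle of the undirected graph; the length restriction excludes it. The girth of an acyclic
  graph is \<open>\<infinity>\<close>.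
\<close>

definition girth :: "('a, 'b) pre_digraph \<Rightarrow> enat" where
  "girth G = (INF p \<in> {p. pre_digraph.cycle G p \<and> 3 \<le> length p}. enat (length p))"

end

theory Submission
  imports Defs
begin

text \<open>
  For \<open>x \<noteq> 0\<close> let \<open>A\<close> be the two-sided annihilator of \<open>x\<close>, an additive subgroup that misses
  the units \<open>1, i, j\<close>. The neighbours of \<open>x\<close> are the elements outside \<open>A \<union> {1, -1, x}\<close>.
  Either two of the cosets \<open>A + 1\<close>, \<open>A + i\<close>, \<open>A + j\<close> differ, and then \<open>A\<close> has at most a third of
  all elements, or both \<open>1 - i\<close> and \<open>1 - j\<close> annihilate \<open>x\<close>; this forces \<open>x = (a, a, a, a)\<close>
  with \<open>2a = 0\<close>, so \<open>x\<^sup>2 = 0\<close> and \<open>x\<close> itself lies in \<open>A\<close>. The minimum degree is attained at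
  \<open>a = 2\<^bsup>n-1\<^esup>\<close>, whose annihilator consists of the quaternions with even coordinate sum. The
  maximum degree is attained at the unit \<open>i\<close>, and \<open>i, j, k\<close> form a triangle.
\<close>

text \<open>Two-sided, because two vertices are non-adjacent only if the products in both orders
  vanish.\<close>

definition annihilator :: "('a, 'b) ring_scheme \<Rightarrow> 'a \<Rightarrow> 'a set" where
  "annihilator R x =
    {y \<in> carrier R. x \<otimes>\<^bsub>R\<^esub> y = \<zero>\<^bsub>R\<^esub> \<and> y \<otimes>\<^bsub>R\<^esub> x = \<zero>\<^bsub>R\<^esub>}"

text \<open>The length restriction in \<open>girth\<close> already gives the lower bound 3, so a
  single triangle suffices.\<close>

lemma girth_triangle:
  assumes "(u, v) \<in> parcs G" "(v, w) \<in> parcs G" "(w, u) \<in> parcs G"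
    and "u \<in> pverts G" "distinct [u, v, w]"
  shows "girth (with_proj G) = 3"
proof -
  let ?p = "[(u, v), (v, w), (w, u)]"
  have "pre_digraph.cycle (with_proj G) ?p"
    unfolding pre_digraph.cycle_def pre_digraph.awalk_def
    by (rule exI[of _ u])
      (use assms in \<open>auto simp: pre_digraph.cas.simps pre_digraph.awalk_verts.simps\<close>)
  then have "girth (with_proj G) \<le> enat (length ?p)"
    unfolding girth_def by (intro INF_lower) simp
  moreover have "3 \<le> girth (with_proj G)"
    unfolding girth_def by (rule INF_greatest) (simp add: numeral_eq_enat)
  ultimately show ?thesis
    by (simp add: numeral_eq_enat numeral_3_eq_3)
qed

section \<open>Annihilators and their additive cosets\<close>

context ring
begin

lemma annihilator_subset: "annihilator R x \<subseteq> carrier R"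
  by (auto simp: annihilator_def)

lemma annihilator_minus:
  assumes "x \<in> carrier R" "a \<in> annihilator R x" "b \<in> annihilator R x"
  shows "a \<ominus> b \<in> annihilator R x"
  using assms by (auto simp: annihilator_def minus_eq l_distr r_distr l_minus r_minus)

lemma card_translate_annihilator:
  assumes "u \<in> carrier R"
  shows "card ((\<lambda>a. a \<oplus> u) ` annihilator R x) = card (annihilator R x)"
  by (rule card_image) (use assms in \<open>auto simp: inj_on_def annihilator_def\<close>)

text \<open>A common element \<open>a \<oplus> u = b \<oplus> v\<close> would put
  \<open>u \<ominus> v = b \<ominus> a\<close> into the annihilator.\<close>

lemma translates_disjoint:
  assumes "x \<in> carrier R" "u \<in> carrier R" "v \<in> carrier R" "u \<ominus> v \<notin> annihilator R x"
  shows "(\<lambda>a. a \<oplus> u) ` annihilator R x \<inter> (\<lambda>a. a \<oplus> v) ` annihilator R x = {}"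
proof -
  have False if ab: "a \<in> annihilator R x" "b \<in> annihilator R x" and eq: "a \<oplus> u = b \<oplus> v" for a b
  proof -
    have c: "a \<in> carrier R" "b \<in> carrier R" using ab by (auto simp: annihilator_def)
    have "u = (\<ominus> a) \<oplus> (b \<oplus> v)"
      using c assms(2) by (simp add: eq[symmetric] r_neg1)
    then have "u = (b \<ominus> a) \<oplus> v"
      using c assms(3) by (simp add: minus_eq a_ac)
    then have "u \<ominus> v = b \<ominus> a"
      using c assms(3) by (simp add: minus_eq a_assoc r_neg)
    then show False using annihilator_minus[OF assms(1) ab(2,1)] assms(4) by simp
  qed
  then show ?thesis by blast
qed

lemma annihilator_eq_translate_zero:
  "annihilator R x = (\<lambda>a. a \<oplus> \<zero>) ` annihilator R x"
  using annihilator_subset by (force simp: image_iff)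

lemma annihilator_disjoint_translate:
  assumes "x \<in> carrier R" "u \<in> carrier R" "u \<notin> annihilator R x"
  shows "annihilator R x \<inter> (\<lambda>a. a \<oplus> u) ` annihilator R x = {}"
  using translates_disjoint[of x u \<zero>] assms annihilator_eq_translate_zero[of x]
  by (auto simp: minus_eq)

text \<open>Since \<open>x \<noteq> \<zero>\<close>, the element \<open>\<one>\<close> does not
  annihilate \<open>x\<close>, so the annihilator and its translate by \<open>\<one>\<close> are
  disjoint and equally large.\<close>

lemma card_annihilator_le_half:
  assumes "finite (carrier R)" "x \<in> carrier R" "x \<noteq> \<zero>"
  shows "2 * card (annihilator R x) \<le> card (carrier R)"
proof -
  let ?A = "annihilator R x" and ?B = "(\<lambda>a. a \<oplus> \<one>) ` annihilator R x"
  have sub: "?A \<union> ?B \<subseteq> carrier R" using annihilator_subset by force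
  have "\<one> \<notin> ?A" using assms by (auto simp: annihilator_def)
  then have "card (?A \<union> ?B) = card ?A + card ?B"
    using annihilator_disjoint_translate[of x \<one>] assms sub
    by (intro card_Un_disjoint) (auto intro: finite_subset)
  with card_mono[OF assms(1) sub] show ?thesis
    by (simp add: card_translate_annihilator)
qed

text \<open>The cosets of \<open>\<zero>\<close>, \<open>u\<close> and \<open>v\<close> are pairwise
  disjoint and equally large.\<close>

lemma card_annihilator_le_third:
  assumes "finite (carrier R)" "x \<in> carrier R" "u \<in> carrier R" "v \<in> carrier R"
    and "u \<notin> annihilator R x" "v \<notin> annihilator R x" "u \<ominus> v \<notin> annihilator R x"
  shows "3 * card (annihilator R x) \<le> card (carrier R)"
proof -
  let ?A = "annihilator R x"
  let ?B = "(\<lambda>a. a \<oplus> u) ` ?A" and ?C = "(\<lambda>a. a \<oplus> v) ` ?A"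
  have sub: "?A \<union> (?B \<union> ?C) \<subseteq> carrier R" using annihilator_subset assms by force
  then have fin: "finite ?A" "finite ?B" "finite ?C"
    using assms(1) by (auto intro: finite_subset)
  have "?A \<inter> ?B = {}" "?A \<inter> ?C = {}" "?B \<inter> ?C = {}"
    using annihilator_disjoint_translate translates_disjoint assms by auto
  then have "card (?A \<union> (?B \<union> ?C)) = card ?A + (card ?B + card ?C)"
    using fin by (subst card_Un_disjoint; (subst card_Un_disjoint)?) auto
  with card_mono[OF assms(1) sub] assms(3,4) show ?thesis
    by (simp add: card_translate_annihilator)
qed

text \<open>Translation by \<open>\<one>\<close> injects the complement of the annihilator into the
  annihilator.\<close>

lemma card_annihilator_ge_half:
  assumes "finite (carrier R)"
    and "\<And>y. y \<in> carrier R \<Longrightarrow> y \<notin> annihilator R x \<Longrightarrow> y \<oplus> \<one> \<in> annihilator R x"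
  shows "card (carrier R) \<le> 2 * card (annihilator R x)"
proof -
  have fin: "finite (annihilator R x)"
    using annihilator_subset assms(1) by (rule finite_subset)
  have "card (carrier R - annihilator R x) \<le> card (annihilator R x)"
    by (rule card_inj_on_le[of "\<lambda>y. y \<oplus> \<one>"]) (use assms fin in \<open>auto simp: inj_on_def\<close>)
  then show ?thesis
    using annihilator_subset fin by (simp add: card_Diff_subset)
qed

section \<open>Degrees in the non-zero divisor graph\<close>

lemma out_degree_nonzero_divisor_graph:
  assumes "x \<in> pverts (nonzero_divisor_graph R)"
  shows "out_degree (with_proj (nonzero_divisor_graph R)) x =
    card (carrier R - annihilator R x - {\<one>, \<ominus> \<one>, x})"
proof -
  \<comment> \<open>The excluded vertex \<open>\<zero>\<close> is removed together with the
    annihilator, which contains it.\<close>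
  have "out_arcs (with_proj (nonzero_divisor_graph R)) x =
      Pair x ` (carrier R - annihilator R x - {\<one>, \<ominus> \<one>, x})"
    using assms
    by (auto simp: out_arcs_def nonzero_divisor_graph_def annihilator_def Let_def image_iff)
  then show ?thesis
    by (simp add: out_degree_def card_image inj_on_def)
qed

lemma pverts_nonzero_divisor_graph:
  "x \<in> pverts (nonzero_divisor_graph R) \<longleftrightarrow>
    x \<in> carrier R \<and> x \<noteq> \<zero> \<and> x \<noteq> \<one> \<and> x \<noteq> \<ominus> \<one>"
  by (auto simp: nonzero_divisor_graph_def Let_def)

lemma parcs_nonzero_divisor_graphI:
  assumes "x \<in> pverts (nonzero_divisor_graph R)" "y \<in> pverts (nonzero_divisor_graph R)"
    and "x \<noteq> y" "x \<otimes> y \<noteq> \<zero>"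
  shows "(x, y) \<in> parcs (nonzero_divisor_graph R)"
  using assms by (simp add: nonzero_divisor_graph_def Let_def)

text \<open>The ring splits into the neighbours of \<open>x\<close>, its annihilator, the set of
  \<open>\<one>\<close> and \<open>\<ominus> \<one>\<close>, and \<open>x\<close> itself unless
  \<open>x\<close> annihilates itself. The count is a sum, which avoids truncated subtraction, and
  \<open>card {\<one>, \<ominus> \<one>}\<close> stays symbolic because the two elements coincide in
  characteristic 2.\<close>

lemma out_degree_plus_card_annihilator:
  assumes fin: "finite (carrier R)" and x: "x \<in> pverts (nonzero_divisor_graph R)"
  shows "out_degree (with_proj (nonzero_divisor_graph R)) x + card (annihilator R x)
      + card {\<one>, \<ominus> \<one>} + (if x \<otimes> x = \<zero> then 0 else 1) = card (carrier R)"
proof -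
  let ?A = "annihilator R x"
  have xv: "x \<in> carrier R" "x \<noteq> \<zero>" "x \<noteq> \<one>" "x \<noteq> \<ominus> \<one>"
    using x by (auto simp: pverts_nonzero_divisor_graph)
  have finA: "finite ?A" using annihilator_subset fin by (rule finite_subset)
  have units: "\<one> \<notin> ?A" "\<ominus> \<one> \<notin> ?A"
    using xv by (auto simp: annihilator_def r_minus)
  have "card (carrier R) = card ?A + card (carrier R - ?A)"
    using annihilator_subset[of x] finA fin
    by (metis card_Diff_subset card_mono le_add_diff_inverse)
  also have "carrier R - ?A =
      (carrier R - ?A - {\<one>, \<ominus> \<one>, x}) \<union> ({\<one>, \<ominus> \<one>} \<union> ({x} - ?A))"
    using units xv by auto
  also have "card \<dots> =
      card (carrier R - ?A - {\<one>, \<ominus> \<one>, x}) + card ({\<one>, \<ominus> \<one>} \<union> ({x} - ?A))"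
    using fin by (intro card_Un_disjoint) auto
  also have "card ({\<one>, \<ominus> \<one>} \<union> ({x} - ?A)) = card {\<one>, \<ominus> \<one>} + card ({x} - ?A)"
    using xv by (intro card_Un_disjoint) auto
  also have "card ({x} - ?A) = (if x \<otimes> x = \<zero> then 0 else 1)"
    using xv by (simp add: annihilator_def insert_Diff_if)
  finally show ?thesis
    by (simp add: out_degree_nonzero_divisor_graph[OF x])
qed

end

section \<open>Quaternions over a commutative ring\<close>

context cring
begin

lemma quat_ring_simps:
  "carrier (quat_ring R) = carrier R \<times> carrier R \<times> carrier R \<times> carrier R"
  "x \<otimes>\<^bsub>quat_ring R\<^esub> y = quat_mult R x y"
  "x \<oplus>\<^bsub>quat_ring R\<^esub> y = quat_add R x y"
  "\<one>\<^bsub>quat_ring R\<^esub> = (\<one>, \<zero>, \<zero>, \<zero>)"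
  "\<zero>\<^bsub>quat_ring R\<^esub> = (\<zero>, \<zero>, \<zero>, \<zero>)"
  by (simp_all add: quat_ring_def)

lemma quat_ring_neg:
  assumes "a \<in> carrier R" "b \<in> carrier R" "c \<in> carrier R" "d \<in> carrier R"
  shows "\<ominus>\<^bsub>quat_ring R\<^esub> (a, b, c, d) = (\<ominus> a, \<ominus> b, \<ominus> c, \<ominus> d)"
proof -
  interpret H: ring "quat_ring R" by (rule quat_ring_ring)
  show ?thesis
    by (rule H.minus_equality) (use assms in \<open>auto simp: quat_ring_simps l_neg\<close>)
qed

text \<open>Multiplication by 1, i or j only permutes the coordinates of \<open>x\<close> up to
  sign, so it cannot kill a nonzero \<open>x\<close>.\<close>

lemma quat_units_not_in_annihilator:
  assumes "x \<in> carrier (quat_ring R)" "x \<noteq> \<zero>\<^bsub>quat_ring R\<^esub>"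
  shows "(\<one>, \<zero>, \<zero>, \<zero>) \<notin> annihilator (quat_ring R) x"
    "(\<zero>, \<one>, \<zero>, \<zero>) \<notin> annihilator (quat_ring R) x"
    "(\<zero>, \<zero>, \<one>, \<zero>) \<notin> annihilator (quat_ring R) x"
  using assms by (cases x; auto simp: annihilator_def quat_ring_simps minus_eq)+

lemma quat_square_zero:
  assumes x: "x \<in> carrier (quat_ring R)"
    and i: "(\<one>, \<zero>, \<zero>, \<zero>) \<ominus>\<^bsub>quat_ring R\<^esub> (\<zero>, \<one>, \<zero>, \<zero>) \<in> annihilator (quat_ring R) x"
    and j: "(\<one>, \<zero>, \<zero>, \<zero>) \<ominus>\<^bsub>quat_ring R\<^esub> (\<zero>, \<zero>, \<one>, \<zero>) \<in> annihilator (quat_ring R) x"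
  shows "x \<otimes>\<^bsub>quat_ring R\<^esub> x = \<zero>\<^bsub>quat_ring R\<^esub>"
proof -
  interpret H: ring "quat_ring R" by (rule quat_ring_ring)
  obtain a b c d where abcd: "x = (a, b, c, d)"
    and car: "a \<in> carrier R" "b \<in> carrier R" "c \<in> carrier R" "d \<in> carrier R"
    using x by (auto simp: quat_ring_simps)
  have eqD: "u = v" if "u \<oplus> \<ominus> v = \<zero>" "u \<in> carrier R" "v \<in> carrier R" for u v
    using that by (metis a_minus_def r_right_minus_eq)
  \<comment> \<open>These are the first two coordinates of x - ix; the next two equations are
    coordinates of x - jx and x - xj.\<close>
  have "a \<oplus> b = \<zero>" "b \<oplus> \<ominus> a = \<zero>"
    using i car
    by (simp_all add: abcd annihilator_def H.minus_eq quat_ring_neg quat_ring_simps minus_eq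
        l_minus r_minus a_ac)
  moreover have "c \<oplus> \<ominus> a = \<zero>" "d \<oplus> \<ominus> b = \<zero>"
    using j car
    by (simp_all add: abcd annihilator_def H.minus_eq quat_ring_neg quat_ring_simps minus_eq
        l_minus r_minus a_ac)
  ultimately have eq: "b = a" "c = a" "d = a" and two: "a \<oplus> a = \<zero>"
    using eqD car by metis+
  \<comment> \<open>Every coordinate of the square is a signed sum of four copies of
    \<open>a \<otimes> a\<close>; as twice this element is zero, signs do not matter and the copies
    cancel in pairs.\<close>
  have "a \<otimes> a \<oplus> a \<otimes> a = \<zero>"
    using two car by (metis r_distr r_null)
  then have "\<ominus> (a \<otimes> a) = a \<otimes> a"
    using car by (intro minus_equality) auto
  then show ?thesis
    using car \<open>a \<otimes> a \<oplus> a \<otimes> a = \<zero>\<close>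
    by (simp add: abcd eq quat_ring_simps minus_eq a_assoc)
qed

lemma quat_ijk_in_pverts:
  assumes "\<one> \<noteq> \<zero>"
  shows "(\<zero>, \<one>, \<zero>, \<zero>) \<in> pverts (nonzero_divisor_graph (quat_ring R))"
    "(\<zero>, \<zero>, \<one>, \<zero>) \<in> pverts (nonzero_divisor_graph (quat_ring R))"
    "(\<zero>, \<zero>, \<zero>, \<one>) \<in> pverts (nonzero_divisor_graph (quat_ring R))"
proof -
  interpret H: ring "quat_ring R" by (rule quat_ring_ring)
  show "(\<zero>, \<one>, \<zero>, \<zero>) \<in> pverts (nonzero_divisor_graph (quat_ring R))"
    "(\<zero>, \<zero>, \<one>, \<zero>) \<in> pverts (nonzero_divisor_graph (quat_ring R))"
    "(\<zero>, \<zero>, \<zero>, \<one>) \<in> pverts (nonzero_divisor_graph (quat_ring R))"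
    unfolding H.pverts_nonzero_divisor_graph using assms
    by (auto simp: quat_ring_simps quat_ring_neg)
qed

text \<open>The edges of the triangle come from ij = k, jk = i and ki = j, all nonzero.\<close>

lemma girth_quat_ring:
  assumes "\<one> \<noteq> \<zero>"
  shows "girth (with_proj (nonzero_divisor_graph (quat_ring R))) = 3"
proof -
  interpret H: ring "quat_ring R" by (rule quat_ring_ring)
  note v = quat_ijk_in_pverts[OF assms]
  show ?thesis
    by (rule girth_triangle[OF H.parcs_nonzero_divisor_graphI[OF v(1,2)]
          H.parcs_nonzero_divisor_graphI[OF v(2,3)] H.parcs_nonzero_divisor_graphI[OF v(3,1)] v(1)])
      (use assms in \<open>auto simp: quat_ring_simps minus_eq\<close>)
qed

text \<open>In the degree count, the annihilator and the self-term together take at least 2 at every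
  vertex. The unit i attains this: only zero annihilates it, and its square is -1.\<close>

lemma max_degree_quat_ring:
  assumes fin: "finite (carrier R)" and "\<one> \<noteq> \<zero>"
  shows "max_degree (with_proj (nonzero_divisor_graph (quat_ring R)))
      + card {\<one>\<^bsub>quat_ring R\<^esub>, \<ominus>\<^bsub>quat_ring R\<^esub> \<one>\<^bsub>quat_ring R\<^esub>} + 2 = card (carrier (quat_ring R))"
proof -
  interpret H: ring "quat_ring R" by (rule quat_ring_ring)
  let ?G = "nonzero_divisor_graph (quat_ring R)"
  let ?i = "(\<zero>, \<one>, \<zero>, \<zero>)"
  let ?d = "out_degree (with_proj ?G)"
  let ?A = "annihilator (quat_ring R)"
  let ?e = "card {\<one>\<^bsub>quat_ring R\<^esub>, \<ominus>\<^bsub>quat_ring R\<^esub> \<one>\<^bsub>quat_ring R\<^esub>}"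
  have finH: "finite (carrier (quat_ring R))" using fin by (simp add: quat_ring_simps)
  note v = quat_ijk_in_pverts(1)[OF assms(2)]
  have sum: "?d x + card (?A x) + ?e
      + (if x \<otimes>\<^bsub>quat_ring R\<^esub> x = \<zero>\<^bsub>quat_ring R\<^esub> then 0 else 1) = card (carrier (quat_ring R))"
    if "x \<in> pverts ?G" for x
    by (rule H.out_degree_plus_card_annihilator[OF finH that])
  have "?A ?i = {\<zero>\<^bsub>quat_ring R\<^esub>}"
    by (auto simp: annihilator_def quat_ring_simps minus_eq)
  then have di: "?d ?i + ?e + 2 = card (carrier (quat_ring R))"
    using sum[OF v] assms(2) by (simp add: quat_ring_simps minus_eq)
  have "?d x \<le> ?d ?i" if x: "x \<in> pverts ?G" for x
  proof -
    have xc: "x \<in> carrier (quat_ring R)"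
      using x by (simp add: H.pverts_nonzero_divisor_graph)
    have finA: "finite (?A x)" using H.annihilator_subset finH by (rule finite_subset)
    have "\<zero>\<^bsub>quat_ring R\<^esub> \<in> ?A x" using xc by (simp add: annihilator_def)
    moreover have "\<zero>\<^bsub>quat_ring R\<^esub> \<noteq> x" using x by (auto simp: H.pverts_nonzero_divisor_graph)
    \<comment> \<open>If \<open>x\<close> squares to zero, both zero and \<open>x\<close> lie in
      \<open>?A x\<close>; otherwise zero contributes 1 and the second summand the other 1.\<close>
    ultimately have "2 \<le> card (?A x) + (if x \<otimes>\<^bsub>quat_ring R\<^esub> x = \<zero>\<^bsub>quat_ring R\<^esub> then 0 else 1)"
      using card_mono[OF finA, of "{\<zero>\<^bsub>quat_ring R\<^esub>, x}"] card_mono[OF finA, of "{\<zero>\<^bsub>quat_ring R\<^esub>}"] xc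
      by (auto simp: annihilator_def)
    then show ?thesis using sum[OF x] di by linarith
  qed
  moreover have "finite (pverts ?G)"
    using finH by (simp add: nonzero_divisor_graph_def Let_def)
  ultimately have "max_degree (with_proj ?G) = ?d ?i"
    unfolding max_degree_def using v by (intro Max_eqI) auto
  with di show ?thesis by simp
qed

text \<open>The element \<open>a\<close> abstracts 2^(n-1) in the integers modulo 2^n: its only
  multiples are \<open>\<zero>\<close> and \<open>a\<close>, and its double vanishes. The vertex
  \<open>(a, a, a, a)\<close> then has an annihilator of index 2 that contains the vertex
  itself.\<close>

lemma min_degree_quat_ring:
  assumes fin: "finite (carrier R)" and "\<one> \<noteq> \<zero>"
    and a: "a \<in> carrier R" "a \<noteq> \<zero>" "\<And>r. r \<in> carrier R \<Longrightarrow> a \<otimes> r = \<zero> \<or> a \<otimes> r = a"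
    and two: "a \<oplus> a = \<zero>"
  shows "2 * (min_degree (with_proj (nonzero_divisor_graph (quat_ring R)))
      + card {\<one>\<^bsub>quat_ring R\<^esub>, \<ominus>\<^bsub>quat_ring R\<^esub> \<one>\<^bsub>quat_ring R\<^esub>}) = card (carrier (quat_ring R))"
proof -
  interpret H: ring "quat_ring R" by (rule quat_ring_ring)
  let ?G = "nonzero_divisor_graph (quat_ring R)"
  let ?d = "out_degree (with_proj ?G)"
  let ?A = "annihilator (quat_ring R)"
  let ?e = "card {\<one>\<^bsub>quat_ring R\<^esub>, \<ominus>\<^bsub>quat_ring R\<^esub> \<one>\<^bsub>quat_ring R\<^esub>}"
  let ?x = "(a, a, a, a)"
  have finH: "finite (carrier (quat_ring R))" using fin by (simp add: quat_ring_simps)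
  have sum: "?d x + card (?A x) + ?e
      + (if x \<otimes>\<^bsub>quat_ring R\<^esub> x = \<zero>\<^bsub>quat_ring R\<^esub> then 0 else 1) = card (carrier (quat_ring R))"
    if "x \<in> pverts ?G" for x
    by (rule H.out_degree_plus_card_annihilator[OF finH that])
  have xc: "?x \<in> carrier (quat_ring R)" "?x \<noteq> \<zero>\<^bsub>quat_ring R\<^esub>"
    using a by (auto simp: quat_ring_simps)
  have neg: "\<ominus> (a \<otimes> r) = a \<otimes> r" if "r \<in> carrier R" for r
    using that a(1) two by (intro minus_equality) (simp_all flip: l_distr)
  \<comment> \<open>By \<open>neg\<close> all signs disappear, so each coordinate of either product
    equals \<open>a\<close> times the coordinate sum.\<close>
  have mem: "(p, q, r, s) \<in> ?A ?x \<longleftrightarrow> a \<otimes> (p \<oplus> q \<oplus> r \<oplus> s) = \<zero>"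
    if "p \<in> carrier R" "q \<in> carrier R" "r \<in> carrier R" "s \<in> carrier R" for p q r s
    using that a(1)
    by (simp add: annihilator_def quat_ring_simps minus_eq neg r_distr a_ac
        m_comm[of p a] m_comm[of q a] m_comm[of r a] m_comm[of s a])
  have "a \<oplus> a \<oplus> a \<oplus> a = \<zero>" using a(1) two by (simp add: a_assoc)
  then have xA: "?x \<in> ?A ?x" using a(1) by (simp add: mem)
  then have sq: "?x \<otimes>\<^bsub>quat_ring R\<^esub> ?x = \<zero>\<^bsub>quat_ring R\<^esub>" by (simp add: annihilator_def)
  \<comment> \<open>A nonzero element of square zero differs from 1 and -1, whose squares are
    1.\<close>
  have xv: "?x \<in> pverts ?G"
    unfolding H.pverts_nonzero_divisor_graph using sq xc by (auto simp: H.l_minus)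
  \<comment> \<open>Adding 1 to \<open>y\<close> raises the coordinate sum by 1, so its product with
    \<open>a\<close> changes from \<open>a\<close> to \<open>a \<oplus> a = \<zero>\<close>.\<close>
  have "y \<oplus>\<^bsub>quat_ring R\<^esub> \<one>\<^bsub>quat_ring R\<^esub> \<in> ?A ?x"
    if y: "y \<in> carrier (quat_ring R)" "y \<notin> ?A ?x" for y
  proof -
    obtain p q r s where y_eq: "y = (p, q, r, s)"
      and c: "p \<in> carrier R" "q \<in> carrier R" "r \<in> carrier R" "s \<in> carrier R"
      using y(1) by (auto simp: quat_ring_simps)
    have "a \<otimes> (p \<oplus> q \<oplus> r \<oplus> s) = a"
      using y(2) c a(3)[of "p \<oplus> q \<oplus> r \<oplus> s"] by (auto simp: y_eq mem)
    then have "a \<otimes> ((p \<oplus> q \<oplus> r \<oplus> s) \<oplus> \<one>) = \<zero>"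
      using c a(1) two by (subst r_distr) auto
    moreover have "(p \<oplus> q \<oplus> r \<oplus> s) \<oplus> \<one> = (p \<oplus> \<one>) \<oplus> q \<oplus> r \<oplus> s"
      using c by (simp add: a_ac)
    ultimately show ?thesis
      using c by (simp add: y_eq quat_ring_simps mem)
  qed
  then have "card (carrier (quat_ring R)) \<le> 2 * card (?A ?x)"
    by (rule H.card_annihilator_ge_half[OF finH])
  then have "2 * card (?A ?x) = card (carrier (quat_ring R))"
    using H.card_annihilator_le_half[OF finH xc] by linarith
  then have dx: "2 * (?d ?x + ?e) = card (carrier (quat_ring R))"
    using sum[OF xv] sq by simp
  \<comment> \<open>A size bound for the case of nonzero square below: with N elements, that case
    needs N/2 \<le> 2N/3 - 1, which holds once N \<ge> 6.\<close>
  have "card {\<zero>, \<one>} \<le> card (carrier R)" using fin by (intro card_mono) auto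
  then have "2 ^ 4 \<le> card (carrier R) ^ 4" using assms(2) by (intro power_mono) auto
  then have big: "16 \<le> card (carrier (quat_ring R))"
    by (simp add: quat_ring_simps card_cartesian_product power4_eq_xxxx mult.assoc)
  have "?d ?x \<le> ?d x" if x: "x \<in> pverts ?G" for x
  proof -
    have xc: "x \<in> carrier (quat_ring R)" "x \<noteq> \<zero>\<^bsub>quat_ring R\<^esub>"
      using x by (auto simp: H.pverts_nonzero_divisor_graph)
    show ?thesis
    proof (cases "x \<otimes>\<^bsub>quat_ring R\<^esub> x = \<zero>\<^bsub>quat_ring R\<^esub>")
      case True
      then show ?thesis
        using sum[OF x] dx H.card_annihilator_le_half[OF finH xc] by simp
    next
      case False
      then have "(\<one>, \<zero>, \<zero>, \<zero>) \<ominus>\<^bsub>quat_ring R\<^esub> (\<zero>, \<one>, \<zero>, \<zero>) \<notin> ?A x \<or>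
          (\<one>, \<zero>, \<zero>, \<zero>) \<ominus>\<^bsub>quat_ring R\<^esub> (\<zero>, \<zero>, \<one>, \<zero>) \<notin> ?A x"
        using quat_square_zero[OF xc(1)] by blast
      \<comment> \<open>The three cosets are those of 0, 1 and either i or j, according to which of
        1 - i and 1 - j fails to annihilate \<open>x\<close>.\<close>
      then have "3 * card (?A x) \<le> card (carrier (quat_ring R))"
        by (elim disjE; intro H.card_annihilator_le_third[OF finH xc(1)])
          (use quat_units_not_in_annihilator[OF xc] in \<open>auto simp: quat_ring_simps(1)\<close>)
      then show ?thesis using sum[OF x] False dx big by simp
    qed
  qed
  moreover have "finite (pverts ?G)"
    using finH by (simp add: nonzero_divisor_graph_def Let_def)
  ultimately have "min_degree (with_proj ?G) = ?d ?x"
    unfolding min_degree_def using xv by (intro Min_eqI) auto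
  with dx show ?thesis by simp
qed

end

section \<open>Specialisation to the integers modulo 2^n\<close>

theorem theorem4p3:
  fixes n :: nat
  assumes "n \<ge> 1"
  shows "let \<Phi> = with_proj (nonzero_divisor_graph (quat_ring (residue_ring (2 ^ n)))) in
    min_degree \<Phi> = (if n = 1 then 2 ^ (4 * n - 1) - 1 else 2 ^ (4 * n - 1) - 2) \<and>
    max_degree \<Phi> = (if n = 1 then 2 ^ (4 * n) - 3 else 2 ^ (4 * n) - 4) \<and>
    girth \<Phi> = 3"
proof -
  have m: "(1::int) < 2 ^ n" using assms by simp
  interpret residues "2 ^ n" "residue_ring (2 ^ n)"
    by unfold_locales (use m in auto)
  let ?R = "residue_ring (2 ^ n)"
  let ?\<Phi> = "with_proj (nonzero_divisor_graph (quat_ring ?R))"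
  let ?e = "card {\<one>\<^bsub>quat_ring ?R\<^esub>, \<ominus>\<^bsub>quat_ring ?R\<^esub> \<one>\<^bsub>quat_ring ?R\<^esub>}"
  \<comment> \<open>The unique element of additive order 2, from which the vertex of minimum degree
    is built.\<close>
  define a :: int where "a = 2 ^ (n - 1)"
  have a: "2 ^ n = 2 * a" "a > 0"
    using assms by (simp_all add: a_def flip: power_Suc)
  have fin: "finite (carrier ?R)" by (simp add: res_carrier_eq)
  have nz: "\<one>\<^bsub>?R\<^esub> \<noteq> \<zero>\<^bsub>?R\<^esub>" by (simp add: res_one_eq res_zero_eq)
  have "card (carrier ?R) = 2 ^ n" by (simp add: res_carrier_eq nat_power_eq)
  then have card: "card (carrier (quat_ring ?R)) = 2 ^ (4 * n)"
    by (simp add: quat_ring_simps card_cartesian_product flip: power_add)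
  have "\<ominus>\<^bsub>quat_ring ?R\<^esub> \<one>\<^bsub>quat_ring ?R\<^esub> = (\<ominus>\<^bsub>?R\<^esub> \<one>\<^bsub>?R\<^esub>, \<zero>\<^bsub>?R\<^esub>, \<zero>\<^bsub>?R\<^esub>, \<zero>\<^bsub>?R\<^esub>)"
    by (simp add: quat_ring_simps quat_ring_neg)
  moreover have "\<ominus>\<^bsub>?R\<^esub> \<one>\<^bsub>?R\<^esub> = 2 ^ n - 1"
    using m by (simp add: res_neg_eq res_one_eq zmod_zminus1_eq_if)
  \<comment> \<open>The source of the case distinction: 1 and -1 coincide exactly for
    \<open>n = 1\<close>, so only one unit is removed there.\<close>
  moreover have "(2::int) ^ n - 1 = 1 \<longleftrightarrow> n = 1"
    using power_inject_exp[of "2::int" n 1] by auto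
  ultimately have e: "?e = (if n = 1 then 1 else 2)"
    by (auto simp: quat_ring_simps(4) res_one_eq)
  have aR: "a \<in> carrier ?R" "a \<noteq> \<zero>\<^bsub>?R\<^esub>"
    unfolding res_carrier_eq res_zero_eq using a by simp_all
  have two: "a \<oplus>\<^bsub>?R\<^esub> a = \<zero>\<^bsub>?R\<^esub>"
    unfolding res_add_eq res_zero_eq using a by simp
  have "a \<otimes>\<^bsub>?R\<^esub> r = \<zero>\<^bsub>?R\<^esub> \<or> a \<otimes>\<^bsub>?R\<^esub> r = a" for r
  proof -
    \<comment> \<open>As the modulus is \<open>2 * a\<close>, only the parity of \<open>r\<close>
      matters.\<close>
    have "(a * r) mod 2 ^ n = a * (r mod 2)"
      using mult_mod_right[of a r 2] by (simp add: a(1) mult.commute)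
    moreover have "r mod 2 = 0 \<or> r mod 2 = 1" by presburger
    ultimately show ?thesis
      by (auto simp: res_mult_eq res_zero_eq)
  qed
  then have "2 * (min_degree ?\<Phi> + ?e) = 2 ^ (4 * n)"
    using min_degree_quat_ring[OF fin nz aR _ two] unfolding card by blast
  moreover have "2 ^ (4 * n) = 2 * (2 ^ (4 * n - 1) :: nat)"
    using assms by (simp flip: power_Suc)
  ultimately have "min_degree ?\<Phi> + ?e = 2 ^ (4 * n - 1)" by simp
  moreover have "max_degree ?\<Phi> + ?e + 2 = 2 ^ (4 * n)"
    using max_degree_quat_ring[OF fin nz] by (simp add: card)
  \<comment> \<open>With \<open>?e\<close> equal to 1 or 2, the two sums yield the stated
    differences, so no subtraction is truncated.\<close>
  ultimately show ?thesis
    using girth_quat_ring[OF nz] unfolding Let_def e by auto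
qed

end
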